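(* Let $X$ and $Y$ be real Hilbert spaces, let $A\colon X\to Y$ be linear, continuous and nonzero, let $b\in Y$, let $\beta\geq\|A^*A\|$, and let $V$ be a closed affine subspace of $X$. Set $f\colon X\to\mathbb{R}\colon x\mapsto\frac12\|Ax-b\|^2$ and $g:=\iota_V$, and suppose that the set $S:=\operatorname{Argmin}(f+g)$ of solutions of the problem of minimizing $\frac12\|Ax-b\|^2$ subject to $x\in V$ is nonempty. Let $T:=\operatorname{P}_{\frac1\beta g}\circ(\operatorname{Id}-\frac1\beta\nabla f)$ be the corresponding proximal gradient operator. Set $v_0:=P_V0$ and $\operatorname{par}V:=V-v_0$. Then, for every $x\in X$, $$Tx=P_{\operatorname{par}V}\big(\operatorname{Id}-\tfrac1\beta A^*A\big)x+\tfrac1\beta P_{\operatorname{par}V}A^*b+v_0.$$ Moreover, if $(t_n)_{n\in\mathbb{N}}$ is a FISTA parameter sequence, $x_0\in X$, and $(x_n)_{n\in\mathbb{N}}$, $(y_n)_{n\in\mathbb{N}}$ are the FISTA sequences generated by $T$, $(t_n)_{n\in\mathbb{N}}$ and the starting point $x_0$, then $(x_n)_{n\in\mathbb{N}}$ and $(y_n)_{n\in\mathbb{N}}$ converge strongly (in norm): $$x_n\to P_Sx_0\quad\text{and}\quad y_n\to P_Sx_0.$$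
   Context: $\mathbb{N}=\{0,1,2,\ldots\}$. $\iota_V$ is the indicator function of $V$ ($0$ on $V$, $+\infty$ elsewhere); affine subspaces are nonempty. $A^*$ is the adjoint of $A$. $\operatorname{P}_{h}$ denotes the proximal operator of a convex, lower semicontinuous, proper function $h$: $\operatorname{P}_h(x)$ is the unique minimizer over $z\in X$ of $h(z)+\frac12\|z-x\|^2$. $\operatorname{Argmin}F$ is the set of minimizers of $F$, and $P_C$ is the metric projection onto a nonempty closed convex set $C$. FISTA parameter sequence: a real sequence $(t_n)_{n\in\mathbb{N}}$ with $t_0=1$ such that for every $n\in\mathbb{N}$, $t_n\geq\frac{n+2}{2}$ and $t_n^2\geq t_{n+1}^2-t_{n+1}$. FISTA sequences: given $x_0\in X$, set $y_0:=x_0$ and, for every $n\in\mathbb{N}$, $x_{n+1}:=Ty_n$ and $y_{n+1}:=x_{n+1}+\frac{t_n-1}{t_{n+1}}(x_{n+1}-x_n)$. *)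

theory Defs
  imports "HOL-Analysis.Analysis"
begin

text \<open>The indicator function of convex analysis, not the 0/1-valued \<open>indicator\<close>.\<close>

definition convex_indicator :: "'a set \<Rightarrow> 'a \<Rightarrow> ereal" where
  "convex_indicator V x = (if x \<in> V then 0 else \<infinity>)"

definition Argmin :: "('a \<Rightarrow> ereal) \<Rightarrow> 'a set" where
  "Argmin F = {x. \<forall>z. F x \<le> F z}"

text \<open>The description is meaningful for convex, lower semicontinuous, proper \<open>h\<close> on a Hilbert
  space, where the minimizer exists and is unique.\<close>

definition prox :: "('a::real_inner \<Rightarrow> ereal) \<Rightarrow> 'a \<Rightarrow> 'a" where
  "prox h x = (THE p. p \<in> Argmin (\<lambda>z. h z + ereal (1/2 * (norm (z - x))\<^sup>2)))"

definition gradient :: "('a::real_inner \<Rightarrow> real) \<Rightarrow> 'a \<Rightarrow> 'a" where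
  "gradient f x = (THE D. GDERIV f x :> D)"

definition prox_grad_op :: "real \<Rightarrow> ('a::real_inner \<Rightarrow> real) \<Rightarrow> ('a \<Rightarrow> ereal) \<Rightarrow> 'a \<Rightarrow> 'a" where
  "prox_grad_op \<beta> f g =
     prox (\<lambda>z. ereal (1/\<beta>) * g z) \<circ> (\<lambda>x. x - (1/\<beta>) *\<^sub>R gradient f x)"

text \<open>The library's \<open>closest_point\<close> requires \<open>heine_borel\<close>, i.e. finite dimension. This
  description is meaningful for nonempty closed convex \<open>C\<close> in a Hilbert space.\<close>

definition metric_proj :: "'a::metric_space set \<Rightarrow> 'a \<Rightarrow> 'a" where
  "metric_proj C x = (THE p. p \<in> C \<and> (\<forall>c\<in>C. dist x p \<le> dist x c))"

definition par :: "'a::real_inner set \<Rightarrow> 'a set" where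
  "par V = (\<lambda>v. v - metric_proj V 0) ` V"

definition fista_parameters :: "(nat \<Rightarrow> real) \<Rightarrow> bool" where
  "fista_parameters t \<longleftrightarrow>
     t 0 = 1 \<and> (\<forall>n. t n \<ge> (real n + 2) / 2 \<and> (t n)\<^sup>2 \<ge> (t (Suc n))\<^sup>2 - t (Suc n))"

definition fista_sequences ::
  "('a::real_vector \<Rightarrow> 'a) \<Rightarrow> (nat \<Rightarrow> real) \<Rightarrow> 'a \<Rightarrow> (nat \<Rightarrow> 'a) \<Rightarrow> (nat \<Rightarrow> 'a) \<Rightarrow> bool" where
  "fista_sequences T t x0 x y \<longleftrightarrow>
     x 0 = x0 \<and> y 0 = x0 \<and>
     (\<forall>n. x (Suc n) = T (y n) \<and>
          y (Suc n) = x (Suc n) + ((t n - 1) / t (Suc n)) *\<^sub>R (x (Suc n) - x n))"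

end

theory Submission
  imports Defs
begin

text \<open>Translating by \<open>s = P\<^sub>S x\<^sub>0\<close>, the shifted iterates satisfy, from the second one on, the
  accelerated gradient recursion of the quadratic form of \<open>Q = 1/\<beta> P A\<^sup>* A P\<close> on the subspace
  \<open>par V\<close>, where \<open>P\<close> is the projection onto \<open>par V\<close>. The usual FISTA energy controls
  \<open>t\<^sub>n x\<^bsub>n+1\<^esub> - (t\<^sub>n - 1) x\<^sub>n\<close> by the starting point, and since \<open>t\<^sub>n \<ge> 1\<close> this bounds the iterates
  themselves: the linear maps sending the starting point to the \<open>n\<close>-th iterate are uniformly bounded. They
  commute with \<open>Q\<close>, and the energy also gives \<open>Q x\<^sub>n \<rightarrow> 0\<close>, so iterates started in the range of
  \<open>Q\<close> tend to \<open>0\<close>; by uniform boundedness so do those started in its closure, the orthogonal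
  complement of the kernel. The choice of \<open>s\<close> as the projection of \<open>x\<^sub>0\<close> puts the starting point
  there.\<close>

section \<open>Projections and adjoints in Hilbert space\<close>

text \<open>The parallelogram law for \<open>c - x\<close> and \<open>d - x\<close>. If both points
  are almost nearest to \<open>x\<close> and their midpoint cannot be nearer, they must be close to
  each other.\<close>

lemma parallelogram_midpoint:
  fixes c d x :: "'a::real_inner"
  shows "(norm (c - d))\<^sup>2 = 2 * (norm (c - x))\<^sup>2 + 2 * (norm (d - x))\<^sup>2
           - 4 * (norm (midpoint c d - x))\<^sup>2"
proof -
  have "2 *\<^sub>R (midpoint c d - x) = (c - x) + (d - x)"
    by (simp add: midpoint_def algebra_simps scaleR_2)
  then have "4 * (norm (midpoint c d - x))\<^sup>2 = (norm ((c - x) + (d - x)))\<^sup>2"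
    by (metis (no_types, lifting) four_x_squared norm_scaleR abs_numeral)
  then show ?thesis
    by (simp add: power2_norm_eq_inner inner_diff inner_add inner_commute algebra_simps)
qed

text \<open>A minimizing sequence is Cauchy: by convexity the midpoint of two of its terms lies in
  \<open>C\<close>, so \<open>parallelogram_midpoint\<close> bounds their squared distance by twice
  the sum of their excesses over the infimum \<open>D\<close>.\<close>

lemma nearest_point_exists:
  fixes C :: "'a::{real_inner, complete_space} set"
  assumes "closed C" "convex C" "C \<noteq> {}"
  shows "\<exists>p\<in>C. \<forall>c\<in>C. dist x p \<le> dist x c"
proof -
  define D where "D = (INF c\<in>C. (norm (c - x))\<^sup>2)"
  have bdd: "bdd_below ((\<lambda>c. (norm (c - x))\<^sup>2) ` C)"
    by (rule bdd_belowI[of _ 0]) auto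
  have D_le: "D \<le> (norm (c - x))\<^sup>2" if "c \<in> C" for c
    unfolding D_def using bdd that by (rule cINF_lower)
  have "\<exists>c\<in>C. (norm (c - x))\<^sup>2 < D + inverse (real (Suc n))" for n
  proof -
    have "D < D + inverse (real (Suc n))" by simp
    then show ?thesis
      unfolding D_def using cINF_less_iff[OF \<open>C \<noteq> {}\<close> bdd] by blast
  qed
  then obtain c where c: "\<And>n. c n \<in> C"
    and c_less: "\<And>n. (norm (c n - x))\<^sup>2 < D + inverse (real (Suc n))"
    by metis
  have close: "(norm (c m - c n))\<^sup>2 \<le> 2 * inverse (real (Suc m)) + 2 * inverse (real (Suc n))" for m n
  proof -
    have "midpoint (c m) (c n) \<in> C"
      using c \<open>convex C\<close> by (meson convex_contains_segment midpoint_in_closed_segment subsetD)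
    from D_le[OF this] show ?thesis
      using parallelogram_midpoint[of "c m" "c n" x] c_less[of m] c_less[of n] by argo
  qed
  have "Cauchy c"
  proof (rule metric_CauchyI)
    fix e :: real assume "0 < e"
    then obtain N where N: "inverse (real (Suc N)) < e\<^sup>2 / 4"
      using reals_Archimedean[of "e\<^sup>2 / 4"] by auto
    have "dist (c m) (c n) < e" if "N \<le> m" "N \<le> n" for m n
    proof -
      have "inverse (real (Suc m)) \<le> inverse (real (Suc N))"
        "inverse (real (Suc n)) \<le> inverse (real (Suc N))"
        using that by (auto intro!: le_imp_inverse_le)
      then have "(norm (c m - c n))\<^sup>2 < e\<^sup>2"
        using close[of m n] N by argo
      then show ?thesis
        using \<open>0 < e\<close> by (simp add: dist_norm power2_less_imp_less)
    qed
    then show "\<exists>N. \<forall>m\<ge>N. \<forall>n\<ge>N. dist (c m) (c n) < e" by blast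
  qed
  then obtain p where p: "c \<longlonglongrightarrow> p"
    using Cauchy_convergent convergent_def by blast
  have "p \<in> C" using closed_sequentially[OF \<open>closed C\<close>] c p by blast
  moreover have "(norm (p - x))\<^sup>2 \<le> D"
  proof (rule LIMSEQ_le)
    show "(\<lambda>n. (norm (c n - x))\<^sup>2) \<longlonglongrightarrow> (norm (p - x))\<^sup>2"
      by (intro tendsto_intros p)
    show "(\<lambda>n. D + inverse (real (Suc n))) \<longlonglongrightarrow> D"
      using tendsto_add[OF tendsto_const LIMSEQ_inverse_real_of_nat] by simp
    show "\<exists>N. \<forall>n\<ge>N. (norm (c n - x))\<^sup>2 \<le> D + inverse (real (Suc n))"
      using c_less less_imp_le by blast
  qed
  then have "dist x p \<le> dist x q" if "q \<in> C" for q
    using D_le[OF that]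
    by (simp add: dist_norm norm_minus_commute power2_le_imp_le)
  ultimately show ?thesis by blast
qed

lemma affine_line:
  assumes "affine V" "p \<in> V" "v \<in> V"
  shows "p + k *\<^sub>R (v - p) \<in> V"
  using mem_affine[OF assms, of "1 - k" k] by (simp add: algebra_simps)

lemma quadratic_nonneg_imp_linear_zero:
  fixes a c :: real
  assumes "\<And>k. 0 \<le> k * a + k\<^sup>2 * c"
  shows "a = 0"
proof (rule ccontr)
  assume "a \<noteq> 0"
  \<comment> \<open>With this \<open>m\<close> the bound \<open>c \<le> m - 1\<close> turns the
    value at \<open>k\<close> into at most \<open>- (a / m)\<^sup>2\<close>, which is
    negative.\<close>
  define m where "m = 1 + \<bar>c\<bar>"
  define k where "k = - a / m"
  have "m > 0" "c \<le> m - 1" unfolding m_def by auto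
  then have "k * a + k\<^sup>2 * c \<le> k * a + k\<^sup>2 * (m - 1)"
    by (simp add: mult_left_mono)
  also have "\<dots> = - (a / m)\<^sup>2"
    unfolding k_def using \<open>m > 0\<close> by (simp add: field_simps power2_eq_square)
  also have "\<dots> < 0"
    using \<open>a \<noteq> 0\<close> \<open>m > 0\<close> by simp
  finally show False using assms[of k] by simp
qed

text \<open>The whole line through \<open>p\<close> and \<open>v\<close> lies in \<open>V\<close>.
  Along it the squared distance to \<open>x\<close> is a quadratic in \<open>k\<close>, minimal at
  \<open>k = 0\<close>, so its linear coefficient vanishes.\<close>

lemma nearest_imp_orthogonal:
  fixes V :: "'a::real_inner set"
  assumes V: "affine V" and p: "p \<in> V" "\<And>c. c \<in> V \<Longrightarrow> dist x p \<le> dist x c" and v: "v \<in> V"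
  shows "(x - p) \<bullet> (v - p) = 0"
proof -
  have "0 \<le> k * (- 2 * ((x - p) \<bullet> (v - p))) + k\<^sup>2 * (norm (v - p))\<^sup>2" for k
  proof -
    have "(norm (x - p))\<^sup>2 \<le> (norm (x - (p + k *\<^sub>R (v - p))))\<^sup>2"
      using p(2)[OF affine_line[OF V p(1) v, of k]] by (simp add: dist_norm power_mono)
    also have "x - (p + k *\<^sub>R (v - p)) = (x - p) - k *\<^sub>R (v - p)" by simp
    also have "(norm ((x - p) - k *\<^sub>R (v - p)))\<^sup>2
        = (norm (x - p))\<^sup>2 + k * (- 2 * ((x - p) \<bullet> (v - p))) + k\<^sup>2 * (norm (v - p))\<^sup>2"
      unfolding power2_norm_eq_inner inner_diff_left[of "x - p"] inner_diff_right[of _ "x - p"]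
      by (simp add: inner_commute[of "v - p" "x - p"] power2_eq_square)
    finally show ?thesis by simp
  qed
  from quadratic_nonneg_imp_linear_zero[OF this] show ?thesis by simp
qed

lemma orthogonal_pythagoras:
  fixes x p c :: "'a::real_inner"
  assumes "(x - p) \<bullet> (c - p) = 0"
  shows "(norm (c - x))\<^sup>2 = (norm (p - x))\<^sup>2 + (norm (c - p))\<^sup>2"
proof -
  have "c - x = (c - p) - (x - p)" by simp
  then have "(norm (c - x))\<^sup>2 = (norm ((c - p) - (x - p)))\<^sup>2" by metis
  also have "\<dots> = (norm (x - p))\<^sup>2 + (norm (c - p))\<^sup>2"
    unfolding power2_norm_eq_inner inner_diff_left[of "c - p"] inner_diff_right[of _ "c - p"]
    using assms by (simp add: inner_commute)
  finally show ?thesis by (simp add: norm_minus_commute)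
qed

lemma orthogonal_imp_dist_le:
  fixes x p c :: "'a::real_inner"
  assumes "(x - p) \<bullet> (c - p) = 0"
  shows "dist x p \<le> dist x c"
  using orthogonal_pythagoras[OF assms]
  by (simp add: dist_norm norm_minus_commute power2_le_imp_le)

text \<open>Pythagoras gives both minimality and uniqueness of \<open>p\<close>, as the definite
  description requires. Projections are identified below through this orthogonality test.\<close>

lemma metric_proj_eqI:
  fixes V :: "'a::real_inner set"
  assumes "p \<in> V" and orth: "\<And>v. v \<in> V \<Longrightarrow> (x - p) \<bullet> (v - p) = 0"
  shows "metric_proj V x = p"
  unfolding metric_proj_def
proof (rule the_equality)
  show "p \<in> V \<and> (\<forall>c\<in>V. dist x p \<le> dist x c)"
    using assms orthogonal_imp_dist_le by blast
  fix q assume q: "q \<in> V \<and> (\<forall>c\<in>V. dist x q \<le> dist x c)"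
  then have "norm (q - x) \<le> norm (p - x)"
    using \<open>p \<in> V\<close> by (simp add: dist_norm norm_minus_commute)
  then have "(norm (q - x))\<^sup>2 \<le> (norm (p - x))\<^sup>2" by (simp add: power_mono)
  then have "(norm (q - p))\<^sup>2 \<le> 0"
    using orthogonal_pythagoras[OF orth] q by fastforce
  then show "q = p" by simp
qed

lemma metric_proj_affine:
  fixes V :: "'a::{real_inner, complete_space} set"
  assumes "closed V" "affine V" "V \<noteq> {}"
  shows metric_proj_in: "metric_proj V x \<in> V"
    and metric_proj_orthogonal: "v \<in> V \<Longrightarrow> (x - metric_proj V x) \<bullet> (v - metric_proj V x) = 0"
proof -
  obtain p where p: "p \<in> V" "\<And>c. c \<in> V \<Longrightarrow> dist x p \<le> dist x c"
    using nearest_point_exists[OF assms(1) _ assms(3)] affine_imp_convex[OF assms(2)] by metis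
  have orth: "(x - p) \<bullet> (v - p) = 0" if "v \<in> V" for v
    using nearest_imp_orthogonal[OF assms(2) p that] .
  have "metric_proj V x = p" using metric_proj_eqI[OF p(1) orth] .
  then show "metric_proj V x \<in> V" "v \<in> V \<Longrightarrow> (x - metric_proj V x) \<bullet> (v - metric_proj V x) = 0"
    using p(1) orth by auto
qed

lemma metric_proj_subspace_eqI:
  fixes U :: "'a::real_inner set"
  assumes "subspace U" "p \<in> U" "\<And>u. u \<in> U \<Longrightarrow> (x - p) \<bullet> u = 0"
  shows "metric_proj U x = p"
  using assms by (intro metric_proj_eqI) (auto simp: subspace_diff)

locale hilbert_subspace =
  fixes U :: "'a::{real_inner, complete_space} set"
  assumes subspace: "subspace U" and closed: "closed U"
begin

abbreviation "P \<equiv> metric_proj U"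

lemma P_in: "P x \<in> U"
  using metric_proj_in[OF closed] subspace subspace_0 subspace_imp_affine by blast

lemma P_orthogonal:
  assumes "u \<in> U"
  shows "(x - P x) \<bullet> u = 0"
proof -
  have "P x + u \<in> U" using subspace P_in assms by (rule subspace_add)
  then have "(x - P x) \<bullet> ((P x + u) - P x) = 0"
    using metric_proj_orthogonal[OF closed] subspace subspace_0 subspace_imp_affine by blast
  then show ?thesis by simp
qed

lemma P_inner: "u \<in> U \<Longrightarrow> P x \<bullet> u = x \<bullet> u"
  using P_orthogonal[of u x] by (simp add: inner_diff_left)

lemma P_id: "u \<in> U \<Longrightarrow> P u = u"
  by (rule metric_proj_subspace_eqI[OF subspace]) auto

lemma linear_P: "linear P"
proof (rule linearI)
  show "P (x + y) = P x + P y" for x y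
    by (rule metric_proj_subspace_eqI[OF subspace])
      (auto simp: subspace_add[OF subspace] P_in inner_diff_left inner_add_left P_inner)
  show "P (c *\<^sub>R x) = c *\<^sub>R P x" for c x
    by (rule metric_proj_subspace_eqI[OF subspace])
      (auto simp: subspace_scale[OF subspace] P_in inner_diff_left P_inner)
qed

lemma P_symmetric: "P x \<bullet> y = x \<bullet> P y"
  by (metis P_in P_inner inner_commute)

lemma norm_P_le: "norm (P x) \<le> norm x"
proof -
  have "(norm (P x))\<^sup>2 = x \<bullet> P x"
    by (simp add: power2_norm_eq_inner P_inner P_in)
  also have "\<dots> \<le> norm x * norm (P x)" by (rule norm_cauchy_schwarz)
  finally show ?thesis
    by (cases "P x = 0") (simp_all add: power2_eq_square)
qed

end

lemma subspace_closure:
  fixes S :: "'a::real_normed_vector set"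
  assumes S: "subspace S"
  shows "subspace (closure S)"
proof (rule subspaceI)
  show "0 \<in> closure S" using subspace_0[OF S] closure_subset by blast
next
  fix x y assume "x \<in> closure S" "y \<in> closure S"
  then obtain f g where "\<forall>n. f n \<in> S" "f \<longlonglongrightarrow> x" "\<forall>n. g n \<in> S" "g \<longlonglongrightarrow> y"
    unfolding closure_sequential by blast
  then have "\<forall>n. f n + g n \<in> S" "(\<lambda>n. f n + g n) \<longlonglongrightarrow> x + y"
    using subspace_add[OF S] tendsto_add by blast+
  then show "x + y \<in> closure S" unfolding closure_sequential by fast
next
  fix c x assume "x \<in> closure S"
  then obtain f where "\<forall>n. f n \<in> S" "f \<longlonglongrightarrow> x"
    unfolding closure_sequential by blast
  then have "\<forall>n. c *\<^sub>R f n \<in> S" "(\<lambda>n. c *\<^sub>R f n) \<longlonglongrightarrow> c *\<^sub>R x"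
    using subspace_scale[OF S] tendsto_scaleR[OF tendsto_const] by blast+
  then show "c *\<^sub>R x \<in> closure S" unfolding closure_sequential by fast
qed

section \<open>Riesz representation and the adjoint\<close>

lemma riesz_representation:
  fixes \<phi> :: "'a::{real_inner, complete_space} \<Rightarrow> real"
  assumes "bounded_linear \<phi>"
  shows "\<exists>r. \<forall>x. \<phi> x = x \<bullet> r"
proof (cases "\<forall>x. \<phi> x = 0")
  case True
  then show ?thesis by (intro exI[of _ 0]) simp
next
  case False
  interpret \<phi>: bounded_linear \<phi> by fact
  interpret K: hilbert_subspace "\<phi> -` {0}"
  proof
    show "subspace (\<phi> -` {0})"
      by (simp add: subspace_def \<phi>.add \<phi>.scaleR \<phi>.zero)
    show "closed (\<phi> -` {0})"
      using \<phi>.isCont[OF continuous_ident] by (intro continuous_closed_vimage) auto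
  qed
  from False obtain z where z: "\<phi> z \<noteq> 0" by blast
  define e where "e = z - K.P z"
  have \<phi>e: "\<phi> e = \<phi> z"
    using K.P_in[of z] by (simp add: e_def \<phi>.diff)
  have "\<phi> x * (e \<bullet> e) = x \<bullet> (\<phi> e *\<^sub>R e)" for x
  proof -
    \<comment> \<open>This combination is killed by \<phi>, while \<open>e\<close> is orthogonal to
      the kernel of \<phi>.\<close>
    have "\<phi> e *\<^sub>R x - \<phi> x *\<^sub>R e \<in> \<phi> -` {0}"
      by (simp add: \<phi>.diff \<phi>.scaleR)
    then have "e \<bullet> (\<phi> e *\<^sub>R x - \<phi> x *\<^sub>R e) = 0"
      unfolding e_def by (rule K.P_orthogonal)
    then show ?thesis by (simp add: inner_diff_right inner_commute)
  qed
  moreover have "e \<bullet> e \<noteq> 0" using \<phi>e z \<phi>.zero by auto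
  ultimately have "\<phi> x = x \<bullet> ((\<phi> e / (e \<bullet> e)) *\<^sub>R e)" for x
    by (simp add: field_simps)
  then show ?thesis by blast
qed

text \<open>\<open>adjoint\<close> is a choice among the maps satisfying this identity; Riesz
  representation shows that there is one.\<close>

lemma adjoint_inner:
  fixes A :: "'x::{real_inner, complete_space} \<Rightarrow> 'y::real_inner"
  assumes "bounded_linear A"
  shows "A x \<bullet> y = x \<bullet> adjoint A y"
proof -
  have "\<exists>r. \<forall>x. A x \<bullet> y = x \<bullet> r" for y
    using bounded_linear_compose[OF bounded_linear_inner_left assms]
    by (rule riesz_representation)
  then have "\<exists>A'. \<forall>x y. A x \<bullet> y = x \<bullet> A' y" by metis
  then show ?thesis unfolding adjoint_def by (rule someI2_ex) blast
qed

lemma bounded_linear_adjoint: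
  fixes A :: "'x::{real_inner, complete_space} \<Rightarrow> 'y::real_inner"
  assumes A: "bounded_linear A"
  shows "bounded_linear (adjoint A)"
proof (rule bounded_linear_intro)
  note adj = adjoint_inner[OF A]
  show "adjoint A (y + z) = adjoint A y + adjoint A z" for y z
    by (simp add: vector_eq_ldot[symmetric] adj[symmetric] inner_add_right)
  show "adjoint A (r *\<^sub>R y) = r *\<^sub>R adjoint A y" for r y
    by (simp add: vector_eq_ldot[symmetric] adj[symmetric])
  show "norm (adjoint A y) \<le> norm y * onorm A" for y
  proof -
    have "(norm (adjoint A y))\<^sup>2 = A (adjoint A y) \<bullet> y"
      by (simp add: adj power2_norm_eq_inner)
    also have "\<dots> \<le> norm (A (adjoint A y)) * norm y" by (rule norm_cauchy_schwarz)
    also have "\<dots> \<le> (onorm A * norm (adjoint A y)) * norm y"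
      by (intro mult_right_mono onorm[OF A]) simp
    finally have "norm (adjoint A y) * norm (adjoint A y) \<le> (norm y * onorm A) * norm (adjoint A y)"
      by (simp add: power2_eq_square mult_ac)
    then show ?thesis
      by (cases "adjoint A y = 0") (simp_all add: onorm_pos_le[OF A])
  qed
qed

section \<open>Proximal gradient operator of constrained least squares\<close>

lemma gradient_eqI:
  assumes "GDERIV f x :> D"
  shows "gradient f x = D"
  unfolding gradient_def
proof (rule the_equality)
  fix E assume "GDERIV f x :> E"
  with assms have "(\<lambda>h. h \<bullet> E) = (\<lambda>h. h \<bullet> D)"
    unfolding gderiv_def by (rule has_derivative_unique[rotated])
  then show "E = D" by (metis vector_eq_ldot)
qed (fact assms)

lemma gradient_least_squares:
  fixes A :: "'x::{real_inner, complete_space} \<Rightarrow> 'y::real_inner"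
  assumes A: "bounded_linear A"
  shows "gradient (\<lambda>x. 1/2 * (norm (A x - b))\<^sup>2) x = adjoint A (A x - b)"
proof (rule gradient_eqI)
  have "((\<lambda>x. 1/2 * ((A x - b) \<bullet> (A x - b))) has_derivative
      (\<lambda>h. 1/2 * ((A x - b) \<bullet> A h + A h \<bullet> (A x - b)))) (at x)"
    by (auto intro!: derivative_eq_intros bounded_linear.has_derivative[OF A])
  then show "GDERIV (\<lambda>x. 1/2 * (norm (A x - b))\<^sup>2) x :> adjoint A (A x - b)"
    unfolding gderiv_def power2_norm_eq_inner
    by (simp add: inner_commute adjoint_inner[OF A, symmetric])
qed

text \<open>A positive factor leaves the indicator unchanged, and since \<open>V\<close> is nonempty
  every minimizer lies in \<open>V\<close>. The predicates under the two definite descriptions are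
  then equivalent.\<close>

lemma prox_scaled_indicator:
  fixes V :: "'a::{real_inner, complete_space} set"
  assumes V: "V \<noteq> {}" and c: "c > 0"
  shows "prox (\<lambda>z. ereal c * convex_indicator V z) x = metric_proj V x"
proof -
  let ?F = "\<lambda>z. ereal c * convex_indicator V z + ereal (1/2 * (norm (z - x))\<^sup>2)"
  have F: "?F z = (if z \<in> V then ereal (1/2 * (norm (z - x))\<^sup>2) else \<infinity>)" for z
    using c by (simp add: convex_indicator_def)
  have "p \<in> Argmin ?F \<longleftrightarrow> p \<in> V \<and> (\<forall>v\<in>V. dist x p \<le> dist x v)" for p
    unfolding Argmin_def F using V
    by (auto simp: dist_norm norm_minus_commute split: if_splits)
  then show ?thesis unfolding prox_def metric_proj_def by simp
qed

lemma affine_linear_image: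
  assumes "linear f" "affine V"
  shows "affine (f ` V)"
  unfolding affine_def
proof clarify
  fix v w and c d :: real
  assume *: "v \<in> V" "w \<in> V" "c + d = 1"
  have "c *\<^sub>R f v + d *\<^sub>R f w = f (c *\<^sub>R v + d *\<^sub>R w)"
    by (simp add: linear_add[OF assms(1)] linear_scale[OF assms(1)])
  then show "c *\<^sub>R f v + d *\<^sub>R f w \<in> f ` V"
    using mem_affine[OF assms(2) *] by simp
qed

lemma Argmin_least_squares:
  fixes A :: "'x::real_vector \<Rightarrow> 'y::real_inner" and b :: "'y"
  assumes A: "linear A" and V: "affine V" "V \<noteq> {}"
  defines "S \<equiv> Argmin (\<lambda>x. ereal (1/2 * (norm (A x - b))\<^sup>2) + convex_indicator V x)"
  shows "s \<in> S \<longleftrightarrow> s \<in> V \<and> (\<forall>v\<in>V. (b - A s) \<bullet> (A v - A s) = 0)"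
proof -
  have "s \<in> S \<longleftrightarrow> s \<in> V \<and> (\<forall>v\<in>V. dist b (A s) \<le> dist b (A v))"
    unfolding S_def Argmin_def convex_indicator_def using V(2)
    by (auto simp: dist_norm norm_minus_commute split: if_splits)
  also have "\<dots> \<longleftrightarrow> s \<in> V \<and> (\<forall>v\<in>V. (b - A s) \<bullet> (A v - A s) = 0)"
    using nearest_imp_orthogonal[OF affine_linear_image[OF A V(1)], of "A s" b]
      orthogonal_imp_dist_le[of b "A s"] by auto
  finally show ?thesis .
qed

text \<open>Adding the normal equation at \<open>v\<close>, tested on \<open>s\<close>, to the one
  at \<open>s\<close>, tested on \<open>v\<close>, gives
  \<open>(norm (A s - A v))\<^sup>2 = 0\<close>. So the solutions form one fibre of \<open>A\<close>
  in \<open>V\<close>.\<close>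

lemma Argmin_least_squares_eq:
  fixes A :: "'x::real_vector \<Rightarrow> 'y::real_inner" and b :: "'y"
  assumes A: "linear A" and V: "affine V"
  defines "S \<equiv> Argmin (\<lambda>x. ereal (1/2 * (norm (A x - b))\<^sup>2) + convex_indicator V x)"
  assumes s: "s \<in> S" "V \<noteq> {}"
  shows "S = {v \<in> V. A v = A s}"
proof -
  note iff = Argmin_least_squares[OF A V s(2), where b = b, folded S_def]
  have "A v = A s" if "v \<in> S" for v
  proof -
    have "(A s - A v) \<bullet> (A s - A v) = (b - A v) \<bullet> (A s - A v) + (b - A s) \<bullet> (A v - A s)"
      by (simp add: inner_diff algebra_simps)
    then show ?thesis using that s(1) unfolding iff by simp
  qed
  moreover have "v \<in> S" if "v \<in> V" "A v = A s" for v
    using s(1) that unfolding iff by simp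
  ultimately show ?thesis using iff by blast
qed

section \<open>Accelerated gradient iteration for a quadratic\<close>

text \<open>The recursion carries the pair of current iterates. Existence is needed to launch an
  auxiliary run from an arbitrary point.\<close>

lemma fista_sequences_exist: "\<exists>x y. fista_sequences T t x0 x y"
proof -
  define p where "p = rec_nat (x0, x0)
    (\<lambda>n (a, b). (T b, T b + ((t n - 1) / t (Suc n)) *\<^sub>R (T b - a)))"
  have "fista_sequences T t x0 (fst \<circ> p) (snd \<circ> p)"
    unfolding fista_sequences_def by (simp add: p_def split_beta)
  then show ?thesis by blast
qed

lemma fista_sequences_linear_image:
  assumes "fista_sequences T t x0 x y" "linear Q" "\<And>z. Q (T z) = T' (Q z)"
  shows "fista_sequences T' t (Q x0) (\<lambda>n. Q (x n)) (\<lambda>n. Q (y n))"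
  using assms(1) linear_add[OF assms(2)] linear_diff[OF assms(2)] linear_scale[OF assms(2)]
  unfolding fista_sequences_def assms(3)[symmetric] by simp

lemma fista_sequences_diff:
  assumes "fista_sequences T t x0 x y" "fista_sequences T t x0' x' y'" "linear T"
  shows "fista_sequences T t (x0 - x0') (\<lambda>n. x n - x' n) (\<lambda>n. y n - y' n)"
proof -
  have "u + k *\<^sub>R (u - v) - (u' + k *\<^sub>R (u' - v')) = u - u' + k *\<^sub>R (u - u' - (v - v'))"
    for u v u' v' :: 'a and k
    by (simp add: algebra_simps)
  then show ?thesis
    using assms(1,2) unfolding fista_sequences_def linear_diff[OF assms(3)] by simp
qed

text \<open>For linear \<open>Q\<close>, \<open>firm\<close> is firm nonexpansiveness; it yields
  both \<open>Q x \<bullet> x \<ge> 0\<close> and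
  \<open>Q x \<bullet> x \<le> (norm x)\<^sup>2\<close>. The map \<open>step\<close> is the gradient
  step of unit length for half of \<open>Q x \<bullet> x\<close>; the factor 1/\<beta> is absorbed
  into \<open>Q\<close>.\<close>

locale quadratic =
  fixes Q :: "'a::real_inner \<Rightarrow> 'a"
  assumes linear_Q: "linear Q"
    and symmetric: "Q x \<bullet> y = x \<bullet> Q y"
    and firm: "(norm (Q x))\<^sup>2 \<le> Q x \<bullet> x"
begin

abbreviation "step x \<equiv> x - Q x"

lemma linear_step: "linear step"
  using linear_compose_sub[OF linear_ident linear_Q] .

lemma norm_Q_le: "norm (Q x) \<le> norm x"
proof -
  have "norm (Q x) * norm (Q x) \<le> norm x * norm (Q x)"
    using firm[of x] norm_cauchy_schwarz[of "Q x" x] by (simp add: power2_eq_square mult.commute)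
  then show ?thesis by (cases "Q x = 0") auto
qed

lemma energy_nonneg: "0 \<le> Q x \<bullet> x"
  using firm[of x] by (meson order_trans zero_le_power2)

lemma energy_le: "Q x \<bullet> x \<le> (norm x)\<^sup>2"
proof -
  have "Q x \<bullet> x \<le> norm (Q x) * norm x" by (rule norm_cauchy_schwarz)
  also have "\<dots> \<le> norm x * norm x" by (rule mult_right_mono[OF norm_Q_le]) simp
  finally show ?thesis by (simp add: power2_eq_square)
qed

text \<open>The right side minus the left side equals \<open>Q (b - z) \<bullet> (b - z)\<close>
  plus \<open>(norm (Q b))\<^sup>2 - Q (Q b) \<bullet> Q b\<close>, and both are
  nonnegative.\<close>

lemma step_descent:
  "Q (step b) \<bullet> step b + (norm (step b - z))\<^sup>2 \<le> Q z \<bullet> z + (norm (b - z))\<^sup>2"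
proof -
  have "0 \<le> Q (b - z) \<bullet> (b - z)" by (rule energy_nonneg)
  also have "Q (b - z) \<bullet> (b - z) = Q b \<bullet> b - 2 * (Q b \<bullet> z) + Q z \<bullet> z"
    using symmetric[of z b] by (simp add: linear_diff[OF linear_Q] inner_diff inner_commute)
  finally have 1: "0 \<le> Q b \<bullet> b - 2 * (Q b \<bullet> z) + Q z \<bullet> z" .
  have "Q (step b) \<bullet> step b = Q b \<bullet> b - 2 * (norm (Q b))\<^sup>2 + Q (Q b) \<bullet> Q b"
    using symmetric[of "Q b" b]
    by (simp add: linear_diff[OF linear_Q] inner_diff power2_norm_eq_inner)
  moreover have "(norm (step b - z))\<^sup>2
      = (norm (b - z))\<^sup>2 - 2 * (Q b \<bullet> b) + 2 * (Q b \<bullet> z) + (norm (Q b))\<^sup>2"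
    by (simp add: inner_diff inner_commute power2_norm_eq_inner)
  ultimately show ?thesis using 1 energy_le[of "Q b"] by argo
qed

text \<open>The descent inequality at \<open>z = (1 - 1/\<tau>) a\<close>, a convex combination of \<open>a\<close> and the
  minimizer \<open>0\<close>, multiplied by \<open>\<tau>\<^sup>2\<close>.\<close>

lemma step_energy:
  assumes "\<tau> \<ge> 1"
  shows "\<tau>\<^sup>2 * (Q (step b) \<bullet> step b) + (norm (\<tau> *\<^sub>R step b - (\<tau> - 1) *\<^sub>R a))\<^sup>2
    \<le> (\<tau>\<^sup>2 - \<tau>) * (Q a \<bullet> a) + (norm (\<tau> *\<^sub>R b - (\<tau> - 1) *\<^sub>R a))\<^sup>2"
proof -
  define r where "r = (\<tau> - 1) / \<tau>"
  have \<tau>r: "\<tau> * r = \<tau> - 1" using assms by (simp add: r_def)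
  have scale: "\<tau>\<^sup>2 * (norm (c - r *\<^sub>R a))\<^sup>2 = (norm (\<tau> *\<^sub>R c - (\<tau> - 1) *\<^sub>R a))\<^sup>2" for c
  proof -
    have "\<tau> *\<^sub>R c - (\<tau> - 1) *\<^sub>R a = \<tau> *\<^sub>R (c - r *\<^sub>R a)"
      by (simp add: scaleR_diff_right \<tau>r)
    then show ?thesis by (simp add: power_mult_distrib)
  qed
  \<comment> \<open>Homogeneity of degree two gives the factor \<open>(\<tau> - 1)\<^sup>2\<close>,
    which is at most \<open>\<tau>\<^sup>2 - \<tau>\<close>, the factor matching the recursion of
    the parameters.\<close>
  have "\<tau>\<^sup>2 * (Q (r *\<^sub>R a) \<bullet> (r *\<^sub>R a)) = (\<tau> - 1)\<^sup>2 * (Q a \<bullet> a)"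
    unfolding \<tau>r[symmetric] by (simp add: linear_scale[OF linear_Q] power2_eq_square)
  also have "\<dots> \<le> (\<tau>\<^sup>2 - \<tau>) * (Q a \<bullet> a)"
    using assms by (intro mult_right_mono energy_nonneg) (simp add: power2_eq_square algebra_simps)
  finally show ?thesis
    using mult_left_mono[OF step_descent[of b "r *\<^sub>R a"], of "\<tau>\<^sup>2"]
    by (simp add: distrib_left scale)
qed

text \<open>The value of \<open>t 0\<close> is left free because the iteration is later run with the
  shifted parameters \<open>t (Suc n)\<close>.\<close>

context
  fixes t :: "nat \<Rightarrow> real"
  assumes t_ge_1: "t n \<ge> 1"
    and t_rec: "(t n)\<^sup>2 \<ge> (t (Suc n))\<^sup>2 - t (Suc n)"
begin

text \<open>Apply \<open>step_energy\<close> with \<open>t (Suc n)\<close>, \<open>y (Suc n)\<close>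
  and \<open>x (Suc n)\<close>. The momentum coefficient makes the last norm equal to the one left
  over from step \<open>n\<close>, and \<open>t_rec\<close> absorbs the factor of the function
  value, so the energy does not increase.\<close>

lemma fista_energy:
  assumes "fista_sequences step t h x y"
  shows "(t n)\<^sup>2 * (Q (x (Suc n)) \<bullet> x (Suc n)) + (norm (t n *\<^sub>R x (Suc n) - (t n - 1) *\<^sub>R x n))\<^sup>2
    \<le> ((t 0)\<^sup>2 - t 0 + 1) * (norm h)\<^sup>2"
proof (induction n)
  case 0
  note s = assms[unfolded fista_sequences_def]
  have "((t 0)\<^sup>2 - t 0) * (Q h \<bullet> h) \<le> ((t 0)\<^sup>2 - t 0) * (norm h)\<^sup>2"
    using t_ge_1[of 0] by (intro mult_left_mono energy_le) (simp add: power2_eq_square)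
  moreover have "t 0 *\<^sub>R h - (t 0 - 1) *\<^sub>R h = h" by (simp add: algebra_simps)
  ultimately show ?case
    using step_energy[OF t_ge_1[of 0], of h h] s by (simp add: distrib_right)
next
  case (Suc n)
  note s = assms[unfolded fista_sequences_def]
  have "t (Suc n) *\<^sub>R y (Suc n) = t (Suc n) *\<^sub>R x (Suc n) + (t n - 1) *\<^sub>R (x (Suc n) - x n)"
    using s t_ge_1[of "Suc n"] by (simp add: scaleR_add_right)
  then have "t (Suc n) *\<^sub>R y (Suc n) - (t (Suc n) - 1) *\<^sub>R x (Suc n)
      = t n *\<^sub>R x (Suc n) - (t n - 1) *\<^sub>R x n"
    by (simp add: algebra_simps)
  then have "(t (Suc n))\<^sup>2 * (Q (x (Suc (Suc n))) \<bullet> x (Suc (Suc n)))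
      + (norm (t (Suc n) *\<^sub>R x (Suc (Suc n)) - (t (Suc n) - 1) *\<^sub>R x (Suc n)))\<^sup>2
    \<le> ((t (Suc n))\<^sup>2 - t (Suc n)) * (Q (x (Suc n)) \<bullet> x (Suc n))
      + (norm (t n *\<^sub>R x (Suc n) - (t n - 1) *\<^sub>R x n))\<^sup>2"
    using step_energy[OF t_ge_1[of "Suc n"], of "y (Suc n)" "x (Suc n)"] s by simp
  also have "\<dots> \<le> (t n)\<^sup>2 * (Q (x (Suc n)) \<bullet> x (Suc n))
      + (norm (t n *\<^sub>R x (Suc n) - (t n - 1) *\<^sub>R x n))\<^sup>2"
    by (intro add_right_mono mult_right_mono t_rec energy_nonneg)
  also note Suc.IH
  finally show ?case .
qed

text \<open>The uniform bound on the linear maps from the starting point to the iterates; its square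
  is the factor in \<open>fista_energy\<close>.\<close>

definition "growth = sqrt ((t 0)\<^sup>2 - t 0 + 1)"

lemma growth_squared: "growth\<^sup>2 = (t 0)\<^sup>2 - t 0 + 1" and growth_ge_1: "growth \<ge> 1"
proof -
  have "(t 0)\<^sup>2 - t 0 \<ge> 0" using t_ge_1[of 0] by (simp add: power2_eq_square)
  then show "growth\<^sup>2 = (t 0)\<^sup>2 - t 0 + 1" "growth \<ge> 1" by (auto simp: growth_def)
qed

text \<open>By the energy bound, \<open>x (Suc n)\<close> is a convex combination of \<open>x n\<close> and a vector of norm at
  most \<open>growth * norm h\<close>.\<close>

lemma fista_bounded:
  assumes "fista_sequences step t h x y"
  shows "norm (x n) \<le> growth * norm h"
proof (induction n)
  case 0
  then show ?case
    using assms growth_ge_1 mult_right_mono[of 1 growth "norm h"] by (simp add: fista_sequences_def)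
next
  case (Suc n)
  have "(norm (t n *\<^sub>R x (Suc n) - (t n - 1) *\<^sub>R x n))\<^sup>2 \<le> (growth * norm h)\<^sup>2"
    using fista_energy[OF assms, of n] mult_nonneg_nonneg[OF zero_le_power2 energy_nonneg]
    unfolding power_mult_distrib growth_squared by (smt (verit))
  then have "norm (t n *\<^sub>R x (Suc n) - (t n - 1) *\<^sub>R x n) \<le> growth * norm h"
    by (rule power2_le_imp_le) (use growth_ge_1 in simp)
  then have "norm (t n *\<^sub>R x (Suc n)) \<le> growth * norm h + norm ((t n - 1) *\<^sub>R x n)"
    using norm_triangle_sub[of "t n *\<^sub>R x (Suc n)" "(t n - 1) *\<^sub>R x n"] by linarith
  also have "norm ((t n - 1) *\<^sub>R x n) \<le> (t n - 1) * (growth * norm h)"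
    using Suc.IH t_ge_1[of n] by (simp add: mult_left_mono)
  finally have "t n * norm (x (Suc n)) \<le> t n * (growth * norm h)"
    using t_ge_1[of n] by (simp add: algebra_simps)
  then show ?case using t_ge_1[of n] by simp
qed

text \<open>The energy bounds \<open>(t n)\<^sup>2 * (Q (x (Suc n)) \<bullet> x (Suc n))\<close>,
  and \<open>firm\<close> passes this to \<open>(norm (Q (x (Suc n))))\<^sup>2\<close>; hence decay
  at rate \<open>1 / t n\<close>.\<close>

lemma fista_Q_tendsto_0:
  assumes "fista_sequences step t h x y" and t_inf: "filterlim t at_top sequentially"
  shows "(\<lambda>n. Q (x n)) \<longlonglongrightarrow> 0"
proof -
  have bound: "norm (Q (x (Suc n))) \<le> growth * norm h / t n" for n
  proof -
    have "(t n * norm (Q (x (Suc n))))\<^sup>2 \<le> (t n)\<^sup>2 * (Q (x (Suc n)) \<bullet> x (Suc n))"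
      unfolding power_mult_distrib by (intro mult_left_mono firm) simp
    also have "\<dots> \<le> (growth * norm h)\<^sup>2"
      using fista_energy[OF assms(1), of n] unfolding power_mult_distrib growth_squared
      by (smt (verit) zero_le_power2)
    finally have "t n * norm (Q (x (Suc n))) \<le> growth * norm h"
      by (rule power2_le_imp_le) (use growth_ge_1 in simp)
    then show ?thesis using t_ge_1[of n] by (simp add: field_simps)
  qed
  have "(\<lambda>n. growth * norm h / t n) \<longlonglongrightarrow> 0"
    using t_inf by (intro tendsto_divide_0[OF tendsto_const] filterlim_at_top_imp_at_infinity)
  then have "(\<lambda>n. Q (x (Suc n))) \<longlonglongrightarrow> 0"
    by (rule Lim_null_comparison[OF always_eventually[OF allI[OF bound]]])
  then show ?thesis by (rule LIMSEQ_imp_Suc)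
qed

text \<open>For \<open>h = Q k\<close> the iterates are \<open>Q\<close> applied to those started at \<open>k\<close>; the uniform bound
  extends convergence to the closure of the range.\<close>

lemma fista_tendsto_0:
  assumes x: "fista_sequences step t h x y" and t_inf: "filterlim t at_top sequentially"
    and h: "h \<in> closure (range Q)"
  shows "x \<longlonglongrightarrow> 0"
proof (rule metric_LIMSEQ_I)
  fix e :: real assume "0 < e"
  then have "0 < e / (2 * growth)" using growth_ge_1 by simp
  then obtain k where k: "dist (Q k) h < e / (2 * growth)"
    using h unfolding closure_approachable by blast
  obtain v w where v: "fista_sequences step t k v w"
    using fista_sequences_exist by blast
  have Qv: "fista_sequences step t (Q k) (\<lambda>n. Q (v n)) (\<lambda>n. Q (w n))"
    by (rule fista_sequences_linear_image[OF v linear_Q]) (rule linear_diff[OF linear_Q])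
  \<comment> \<open>The difference of the two runs is itself a run, started at
    \<open>h - Q k\<close>, so the bound is uniform in \<open>n\<close>.\<close>
  have "norm (x n - Q (v n)) \<le> growth * norm (h - Q k)" for n
    using fista_bounded[OF fista_sequences_diff[OF x Qv linear_step]] .
  also have "growth * norm (h - Q k) \<le> e / 2"
    using k growth_ge_1 by (simp add: dist_norm norm_minus_commute field_simps)
  finally have near: "norm (x n - Q (v n)) \<le> e / 2" for n .
  obtain N where N: "\<And>n. n \<ge> N \<Longrightarrow> norm (Q (v n)) < e / 2"
    using metric_LIMSEQ_D[OF fista_Q_tendsto_0[OF v t_inf], of "e / 2"] \<open>0 < e\<close> by auto
  have "dist (x n) 0 < e" if "n \<ge> N" for n
    using norm_triangle_ineq[of "x n - Q (v n)" "Q (v n)"] near[of n] N[OF that] by simp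
  then show "\<exists>N. \<forall>n\<ge>N. dist (x n) 0 < e" by blast
qed

end

end

text \<open>The residual of projecting \<open>h\<close> onto the closed range is orthogonal to the
  range, hence in the kernel by symmetry. It is then orthogonal to \<open>h\<close> and to the
  projection, so to itself.\<close>

lemma orthogonal_kernel_in_closure_range:
  fixes Q :: "'a::{real_inner, complete_space} \<Rightarrow> 'a"
  assumes "quadratic Q" and h: "\<And>k. Q k = 0 \<Longrightarrow> h \<bullet> k = 0"
  shows "h \<in> closure (range Q)"
proof -
  interpret quadratic Q by fact
  interpret R: hilbert_subspace "closure (range Q)"
    using subspace_closure[OF linear_subspace_image[OF linear_Q subspace_UNIV]]
    by unfold_locales simp_all
  let ?k = "h - R.P h"
  have "?k \<bullet> Q z = 0" for z
    by (rule R.P_orthogonal) (rule subsetD[OF closure_subset], simp)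
  then have "Q ?k = 0"
    by (metis inner_eq_zero_iff symmetric)
  then have "h \<bullet> ?k = 0" by (rule h)
  moreover have "R.P h \<bullet> ?k = 0"
    using R.P_orthogonal[OF R.P_in] by (simp add: inner_commute)
  ultimately have "?k \<bullet> ?k = 0" by (simp add: inner_diff_left)
  then have "h = R.P h" by simp
  then show ?thesis using R.P_in by metis
qed

section \<open>Reduction of FISTA to the quadratic iteration\<close>

lemma hilbert_subspace_par:
  fixes V :: "'a::{real_inner, complete_space} set"
  assumes "closed V" "affine V" "V \<noteq> {}"
  shows "hilbert_subspace (par V)"
proof
  show "subspace (par V)"
    unfolding par_def using affine_diffs_subspace_subtract[OF assms(2)] metric_proj_in[OF assms]
    by blast
  show "closed (par V)"
    unfolding par_def using closed_translation_subtract[OF assms(1)] by blast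
qed

lemma mem_par_iff: "u \<in> par V \<longleftrightarrow> metric_proj V 0 + u \<in> V"
  unfolding par_def by (force simp: image_iff algebra_simps)

lemma diff_mem_par:
  fixes V :: "'a::{real_inner, complete_space} set"
  assumes "closed V" "affine V" "V \<noteq> {}" "v \<in> V" "w \<in> V"
  shows "v - w \<in> par V"
proof -
  interpret hilbert_subspace "par V" using hilbert_subspace_par[OF assms(1-3)] .
  have "(v - metric_proj V 0) - (w - metric_proj V 0) \<in> par V"
    by (rule subspace_diff[OF subspace]) (simp_all add: mem_par_iff assms(4,5))
  then show ?thesis by simp
qed

text \<open>As the projection of 0, the base point \<open>metric_proj V 0\<close> is orthogonal to
  \<open>par V\<close>, so adding it to the projection onto \<open>par V\<close> keeps the residual
  normal to \<open>V\<close>.\<close>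

lemma metric_proj_affine_eq_par:
  fixes V :: "'a::{real_inner, complete_space} set"
  assumes V: "closed V" "affine V" "V \<noteq> {}"
  shows "metric_proj V x = metric_proj (par V) x + metric_proj V 0"
proof (rule metric_proj_eqI)
  interpret hilbert_subspace "par V" using hilbert_subspace_par[OF V] .
  let ?v0 = "metric_proj V 0"
  show p: "P x + ?v0 \<in> V"
    using P_in[of x] by (simp add: mem_par_iff add.commute)
  fix v assume "v \<in> V"
  let ?w = "v - (P x + ?v0)"
  have w: "?w \<in> par V" using diff_mem_par[OF V \<open>v \<in> V\<close> p] .
  have "(0 - ?v0) \<bullet> ((?v0 + ?w) - ?v0) = 0"
    using w unfolding mem_par_iff by (rule metric_proj_orthogonal[OF V])
  then have "?v0 \<bullet> ?w = 0"
    by (simp only: add_diff_cancel_left' diff_0 inner_minus_left neg_equal_0_iff_equal)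
  then show "(x - (P x + ?v0)) \<bullet> ?w = 0"
    using P_orthogonal[OF w, of x] by (simp add: inner_diff_left inner_add_left)
qed

section \<open>Norm bounds for the adjoint and for the compression of
  \<open>adjoint A \<circ> A\<close>\<close>

lemma norm_square_le_onorm_adjoint:
  fixes A :: "'x::{real_inner, complete_space} \<Rightarrow> 'y::real_inner"
  assumes A: "bounded_linear A"
  shows "(norm (A x))\<^sup>2 \<le> onorm (adjoint A \<circ> A) * (norm x)\<^sup>2"
proof -
  have bl: "bounded_linear (adjoint A \<circ> A)"
    unfolding o_def using bounded_linear_compose[OF bounded_linear_adjoint[OF A] A] .
  have "(norm (A x))\<^sup>2 = x \<bullet> (adjoint A \<circ> A) x"
    by (simp add: power2_norm_eq_inner adjoint_inner[OF A])
  also have "\<dots> \<le> norm x * norm ((adjoint A \<circ> A) x)" by (rule norm_cauchy_schwarz)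
  also have "\<dots> \<le> norm x * (onorm (adjoint A \<circ> A) * norm x)"
    by (intro mult_left_mono onorm[OF bl]) simp
  finally show ?thesis by (simp add: power2_eq_square mult_ac)
qed

text \<open>A bound for \<open>A\<close> passes to its adjoint: apply Cauchy-Schwarz to
  \<open>A (adjoint A y) \<bullet> y\<close>, square, use the bound at \<open>adjoint A y\<close>,
  and cancel.\<close>

lemma norm_adjoint_square_le:
  fixes A :: "'x::{real_inner, complete_space} \<Rightarrow> 'y::real_inner"
  assumes A: "bounded_linear A" and "\<beta> > 0" and le: "\<And>x. (norm (A x))\<^sup>2 \<le> \<beta> * (norm x)\<^sup>2"
  shows "(norm (adjoint A y))\<^sup>2 \<le> \<beta> * (norm y)\<^sup>2"
proof (cases "adjoint A y = 0")
  case True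
  then show ?thesis using \<open>\<beta> > 0\<close> by simp
next
  case False
  have "(norm (adjoint A y))\<^sup>2 = A (adjoint A y) \<bullet> y"
    by (simp add: adjoint_inner[OF A] power2_norm_eq_inner)
  also have "\<dots> \<le> norm (A (adjoint A y)) * norm y" by (rule norm_cauchy_schwarz)
  finally have "((norm (adjoint A y))\<^sup>2)\<^sup>2 \<le> (norm (A (adjoint A y)))\<^sup>2 * (norm y)\<^sup>2"
    by (metis power_mono power_mult_distrib zero_le_power2)
  also have "\<dots> \<le> (\<beta> * (norm (adjoint A y))\<^sup>2) * (norm y)\<^sup>2"
    by (intro mult_right_mono le) simp
  finally have "(norm (adjoint A y))\<^sup>2 * (norm (adjoint A y))\<^sup>2
      \<le> (\<beta> * (norm y)\<^sup>2) * (norm (adjoint A y))\<^sup>2"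
    by (simp add: power2_eq_square mult_ac)
  then show ?thesis by (rule mult_right_le_imp_le) (use False in simp)
qed

lemma (in hilbert_subspace) compression_inner:
  fixes A :: "'a \<Rightarrow> 'y::real_inner"
  assumes "bounded_linear A"
  shows "P (adjoint A (A (P x))) \<bullet> y = A (P x) \<bullet> A (P y)"
  by (metis P_symmetric adjoint_inner[OF assms] inner_commute)

text \<open>The inner projection makes the operator symmetric on the whole space. Firmness is the
  adjoint bound at \<open>A (P x)\<close>: dividing by \<beta> twice leaves
  \<open>(1/\<beta>) * (norm (A (P x)))\<^sup>2\<close>, which is the quadratic form.\<close>

lemma (in hilbert_subspace) quadratic_compression:
  fixes A :: "'a \<Rightarrow> 'y::real_inner"
  assumes A: "bounded_linear A" and \<beta>: "\<beta> > 0"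
    and le: "\<And>x. (norm (A x))\<^sup>2 \<le> \<beta> * (norm x)\<^sup>2"
  shows "quadratic (\<lambda>x. (1/\<beta>) *\<^sub>R P (adjoint A (A (P x))))"
proof (rule quadratic.intro)
  let ?Q = "\<lambda>x. (1/\<beta>) *\<^sub>R P (adjoint A (A (P x)))"
  note linear = bounded_linear.linear[OF A] bounded_linear.linear[OF bounded_linear_adjoint[OF A]]
  show "linear ?Q"
    using linear_compose[OF linear_compose[OF linear_compose[OF linear_P linear(1)] linear(2)] linear_P]
    by (intro linear_compose_scale_right) (simp add: o_def)
  have inner: "?Q x \<bullet> y = (1/\<beta>) * (A (P x) \<bullet> A (P y))" for x y
    by (simp add: compression_inner[OF A])
  show "?Q x \<bullet> y = x \<bullet> ?Q y" for x y
    unfolding inner inner_commute[of x] by (simp only: inner inner_commute)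
  fix x
  have "(norm (?Q x))\<^sup>2 = (1/\<beta>)\<^sup>2 * (norm (P (adjoint A (A (P x)))))\<^sup>2"
    by (simp add: power_divide)
  also have "\<dots> \<le> (1/\<beta>)\<^sup>2 * (\<beta> * (norm (A (P x)))\<^sup>2)"
    by (intro mult_left_mono order_trans[OF power_mono[OF norm_P_le norm_ge_zero]
          norm_adjoint_square_le[OF A \<beta> le]]) simp
  also have "\<dots> = ?Q x \<bullet> x"
    unfolding inner using \<beta> by (simp add: power2_norm_eq_inner) (simp add: power2_eq_square)
  finally show "(norm (?Q x))\<^sup>2 \<le> ?Q x \<bullet> x" .
qed

section \<open>Growth of the parameters and convergence of the extrapolated sequence\<close>

lemma fista_parameters_ge_1:
  assumes "fista_parameters t"
  shows "1 \<le> t n"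
proof -
  have "(real n + 2) / 2 \<le> t n"
    using assms unfolding fista_parameters_def by blast
  moreover have "1 \<le> (real n + 2) / 2" by simp
  ultimately show ?thesis by linarith
qed

lemma fista_parameters_at_top:
  assumes "fista_parameters t"
  shows "filterlim t at_top sequentially"
proof (rule filterlim_at_top_mono)
  show "filterlim (\<lambda>n. real n / 2) at_top sequentially"
    by (rule filterlim_tendsto_pos_mult_at_top[OF _ _ filterlim_real_sequentially,
          of "\<lambda>_. 1/2" "1/2", simplified])
  show "\<forall>\<^sub>F n in sequentially. real n / 2 \<le> t n"
    using assms unfolding fista_parameters_def
    by (intro always_eventually) (smt (verit) divide_right_mono)
qed

text \<open>Increments are at most 1, since a larger one would make
  \<open>t (Suc n) * (t (Suc n) - 1)\<close> exceed \<open>(t n)\<^sup>2\<close>. With the lower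
  bound on the parameters this bounds the momentum coefficients.\<close>

lemma fista_parameters_le:
  assumes "fista_parameters t"
  shows "t n \<le> real n + 1"
proof (induction n)
  case 0
  then show ?case using assms by (simp add: fista_parameters_def)
next
  case (Suc n)
  have "t (Suc n) \<le> t n + 1"
  proof (rule ccontr)
    assume "\<not> t (Suc n) \<le> t n + 1"
    moreover have "0 < t n" using fista_parameters_ge_1[OF assms, of n] by linarith
    ultimately have "(t n + 1) * t n < t (Suc n) * (t (Suc n) - 1)"
      by (intro mult_strict_mono) auto
    moreover have "t (Suc n) * (t (Suc n) - 1) \<le> t n * t n"
      using assms unfolding fista_parameters_def by (simp add: power2_eq_square algebra_simps)
    ultimately show False using \<open>0 < t n\<close> by (simp add: algebra_simps)
  qed
  then show ?case using Suc.IH by simp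
qed

lemma fista_momentum_le:
  assumes "fista_parameters t"
  shows "\<bar>(t n - 1) / t (Suc n)\<bar> \<le> 2"
proof -
  have "(real (Suc n) + 2) / 2 \<le> t (Suc n)"
    using assms unfolding fista_parameters_def by blast
  then have "t n - 1 \<le> 2 * t (Suc n)"
    using fista_parameters_le[OF assms, of n] by (simp add: field_simps)
  then show ?thesis
    using fista_parameters_ge_1[OF assms, of n] fista_parameters_ge_1[OF assms, of "Suc n"]
    by (simp add: field_simps)
qed

text \<open>Bounded momentum times a vanishing difference of consecutive iterates tends to
  0.\<close>

lemma fista_y_tendsto:
  assumes "fista_parameters t" "fista_sequences T t x0 x y" and x: "x \<longlonglongrightarrow> (l::'a::real_normed_vector)"
  shows "y \<longlonglongrightarrow> l"
proof -
  have "(\<lambda>n. x (Suc n) - x n) \<longlonglongrightarrow> 0"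
    using tendsto_diff[OF LIMSEQ_Suc[OF x] x] by simp
  then have lim: "(\<lambda>n. 2 * norm (x (Suc n) - x n)) \<longlonglongrightarrow> 0"
    by (intro tendsto_mult_right_zero tendsto_norm_zero)
  have bound: "norm (((t n - 1) / t (Suc n)) *\<^sub>R (x (Suc n) - x n)) \<le> 2 * norm (x (Suc n) - x n)" for n
    unfolding norm_scaleR by (intro mult_right_mono fista_momentum_le[OF assms(1)]) simp
  have "(\<lambda>n. ((t n - 1) / t (Suc n)) *\<^sub>R (x (Suc n) - x n)) \<longlonglongrightarrow> 0"
    by (rule Lim_null_comparison[OF always_eventually[OF allI[OF bound]] lim])
  from tendsto_add[OF LIMSEQ_Suc[OF x] this]
  have "(\<lambda>n. x (Suc n) + ((t n - 1) / t (Suc n)) *\<^sub>R (x (Suc n) - x n)) \<longlonglongrightarrow> l"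
    by simp
  moreover have "y (Suc n) = x (Suc n) + ((t n - 1) / t (Suc n)) *\<^sub>R (x (Suc n) - x n)" for n
    using assms(2) unfolding fista_sequences_def by blast
  ultimately have "(\<lambda>n. y (Suc n)) \<longlonglongrightarrow> l" by simp
  then show ?thesis by (rule LIMSEQ_imp_Suc)
qed

theorem theorem4p1:
  fixes A :: "'x::{real_inner, complete_space} \<Rightarrow> 'y::{real_inner, complete_space}"
    and b :: 'y
    and \<beta> :: real
    and V :: "'x set"
    and f :: "'x \<Rightarrow> real"
    and g :: "'x \<Rightarrow> ereal"
    and S :: "'x set"
    and T :: "'x \<Rightarrow> 'x"
    and v0 :: 'x
  assumes A_bounded_linear: "bounded_linear A"
    and A_nonzero: "A \<noteq> (\<lambda>x. 0)"
    and beta: "\<beta> \<ge> onorm (adjoint A \<circ> A)"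
    and V: "closed V" "affine V" "V \<noteq> {}"
    and f_def: "f = (\<lambda>x. 1/2 * (norm (A x - b))\<^sup>2)"
    and g_def: "g = convex_indicator V"
    and S_def: "S = Argmin (\<lambda>x. ereal (f x) + g x)"
    and S_nonempty: "S \<noteq> {}"
    and T_def: "T = prox_grad_op \<beta> f g"
    and v0_def: "v0 = metric_proj V 0"
  shows "(\<forall>x. T x = metric_proj (par V) (x - (1/\<beta>) *\<^sub>R adjoint A (A x))
                    + (1/\<beta>) *\<^sub>R metric_proj (par V) (adjoint A b) + v0)
       \<and> (\<forall>t x0 x y. fista_parameters t \<longrightarrow> fista_sequences T t x0 x y \<longrightarrow>
            x \<longlonglongrightarrow> metric_proj S x0 \<and> y \<longlonglongrightarrow> metric_proj S x0)"
proof -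
  let ?A' = "adjoint A"
  interpret A: bounded_linear A by fact
  interpret A': bounded_linear ?A' by (rule bounded_linear_adjoint) fact
  note adj = adjoint_inner[OF A_bounded_linear]
  have adj': "?A' y \<bullet> x = y \<bullet> A x" for x y
    by (metis adj inner_commute)
  interpret U: hilbert_subspace "par V" by (rule hilbert_subspace_par) fact+
  interpret P: linear U.P by (rule U.linear_P)
  have A_le: "(norm (A x))\<^sup>2 \<le> \<beta> * (norm x)\<^sup>2" for x
    using norm_square_le_onorm_adjoint[OF A_bounded_linear, of x] mult_right_mono[OF beta zero_le_power2, of "norm x"]
    by linarith
  have \<beta>: "\<beta> > 0"
  proof -
    obtain x where "A x \<noteq> 0" using A_nonzero by blast
    then have "0 < \<beta> * (norm x)\<^sup>2"
      using A_le[of x] by (smt (verit) zero_less_norm_iff zero_less_power)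
    then show ?thesis by (simp add: zero_less_mult_iff)
  qed
  have T_proj: "T x = metric_proj V (x - (1/\<beta>) *\<^sub>R ?A' (A x - b))" for x
    unfolding T_def prox_grad_op_def f_def g_def o_def gradient_least_squares[OF A_bounded_linear]
    using \<beta> by (intro prox_scaled_indicator[OF V(3)]) simp
  have T_formula: "T x = U.P (x - (1/\<beta>) *\<^sub>R ?A' (A x)) + (1/\<beta>) *\<^sub>R U.P (?A' b) + v0" for x
    unfolding T_proj metric_proj_affine_eq_par[OF V, of "x - _"] v0_def
    by (simp add: A'.diff scaleR_diff_right P.diff P.scaleR P.add algebra_simps)

  have S_iff: "s \<in> S \<longleftrightarrow> s \<in> V \<and> (\<forall>v\<in>V. (b - A s) \<bullet> (A v - A s) = 0)" for s
    unfolding S_def f_def g_def by (rule Argmin_least_squares[OF A.linear_axioms V(2,3)])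
  have S_eq: "S = {v \<in> V. A v = A s}" if "s \<in> S" for s
    using Argmin_least_squares_eq[OF A.linear_axioms V(2) _ V(3)] that
    unfolding S_def f_def g_def by blast
  \<comment> \<open>The displacement of the gradient step at a solution is normal to
    \<open>V\<close> by the normal equation, so projecting back onto \<open>V\<close> returns
    \<open>s\<close>.\<close>
  have T_fixed: "T s = s" if "s \<in> S" for s
  proof -
    have "(s - (1/\<beta>) *\<^sub>R ?A' (A s - b) - s) \<bullet> (v - s) = (1/\<beta>) * ((b - A s) \<bullet> (A v - A s))" for v
      by (simp add: inner_commute[of "?A' _"] adj[symmetric] A.diff inner_diff algebra_simps inner_commute)
    then show ?thesis
      unfolding T_proj using that S_iff by (intro metric_proj_eqI) auto
  qed
  obtain s0 where s0: "s0 \<in> S" using S_nonempty by blast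
  have S_closed: "closed S"
  proof -
    have "S = V \<inter> A -` {A s0}" using S_eq[OF s0] by blast
    then show ?thesis
      using V(1) A.isCont[OF continuous_ident] by (auto intro!: closed_Int continuous_closed_vimage)
  qed
  have S_affine: "affine S"
    unfolding S_eq[OF s0] affine_def using V(2)
    by (auto simp: affine_def A.add A.scaleR scaleR_add_left[symmetric])

  define Q where "Q = (\<lambda>x. (1/\<beta>) *\<^sub>R U.P (?A' (A (U.P x))))"
  interpret Q: quadratic Q
    unfolding Q_def by (rule U.quadratic_compression[OF A_bounded_linear \<beta> A_le])

  have "x \<longlonglongrightarrow> metric_proj S x0"
    if t: "fista_parameters t" and xy: "fista_sequences T t x0 x y" for t x0 x y
  proof -
    define s where "s = metric_proj S x0"
    have s: "s \<in> S" and s_orth: "\<And>v. v \<in> S \<Longrightarrow> (x0 - s) \<bullet> (v - s) = 0"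
      unfolding s_def using metric_proj_affine[OF S_closed S_affine S_nonempty] by auto
    \<comment> \<open>Subtracting the fixed point cancels the constant terms of
      \<open>T_formula\<close>; on \<open>par V\<close>, where \<open>U.P\<close> is the identity,
      what remains is \<open>z - Q z\<close>.\<close>
    have T_s: "T z - s = U.P (z - s) - (1/\<beta>) *\<^sub>R U.P (?A' (A (z - s)))" for z
    proof -
      have "T z - s = T z - T s" using T_fixed[OF s] by simp
      then show ?thesis
        unfolding T_formula
        by (simp add: P.diff P.scaleR A.diff A'.diff algebra_simps)
    qed
    have T_in: "T z - s \<in> par V" for z
      unfolding T_s by (intro subspace_diff subspace_scale U.subspace U.P_in)
    note xy' = xy[unfolded fista_sequences_def]
    \<comment> \<open>The starting point \<open>x0\<close> may lie outside \<open>V\<close>, hence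
      the shift by one. For \<open>n = 0\<close>, \<open>t 0 = 1\<close> kills the momentum and
      \<open>y (Suc 0) = x (Suc 0)\<close>.\<close>
    have y_in: "y (Suc n) - s \<in> par V" for n
    proof (cases n)
      case 0
      then show ?thesis using xy' t T_in by (simp add: fista_parameters_def)
    next
      case (Suc m)
      have "x (Suc n) - s \<in> par V" "x n - s \<in> par V"
        using xy' T_in Suc by auto
      then have "(x (Suc n) - s) + ((t n - 1) / t (Suc n)) *\<^sub>R ((x (Suc n) - s) - (x n - s)) \<in> par V"
        by (intro subspace_add subspace_diff[of _ "_ - s"] subspace_scale U.subspace)
      moreover have "y (Suc n) - s
          = (x (Suc n) - s) + ((t n - 1) / t (Suc n)) *\<^sub>R ((x (Suc n) - s) - (x n - s))"
        using xy' by simp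
      ultimately show ?thesis by metis
    qed
    define h where "h = x (Suc 0) - s"
    have shifted: "fista_sequences (\<lambda>z. z - Q z) (\<lambda>n. t (Suc n)) h
        (\<lambda>n. x (Suc n) - s) (\<lambda>n. y (Suc n) - s)"
      unfolding fista_sequences_def
    proof (intro conjI allI)
      show "y (Suc 0) - s = h" using xy' t by (simp add: h_def fista_parameters_def)
      fix n
      show "x (Suc (Suc n)) - s = y (Suc n) - s - Q (y (Suc n) - s)"
        using xy' T_s[of "y (Suc n)"] unfolding Q_def U.P_id[OF y_in] by metis
      show "y (Suc (Suc n)) - s = x (Suc (Suc n)) - s
          + ((t (Suc n) - 1) / t (Suc (Suc n))) *\<^sub>R (x (Suc (Suc n)) - s - (x (Suc n) - s))"
        using xy' by simp
    qed (simp add: h_def)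
    \<comment> \<open>If \<open>Q k = 0\<close>, then \<open>A (U.P k) = 0\<close>, so moving from
      \<open>s\<close> along \<open>U.P k\<close> stays in \<open>S\<close> and
      \<open>x0 - s\<close> is orthogonal to that direction. Moving the projections in
      \<open>h = T x0 - s\<close> onto \<open>k\<close> leaves only terms that vanish.\<close>
    have "h \<bullet> k = 0" if "Q k = 0" for k
    proof -
      have "(norm (A (U.P k)))\<^sup>2 = \<beta> * (Q k \<bullet> k)"
        using \<beta> by (simp add: Q_def U.compression_inner[OF A_bounded_linear] power2_norm_eq_inner)
      with that have Ak: "A (U.P k) = 0" by simp
      have "s + U.P k \<in> V"
      proof -
        have "(s - v0) + U.P k \<in> par V"
          using s S_iff by (intro subspace_add U.subspace U.P_in) (simp add: mem_par_iff v0_def)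
        then show ?thesis by (simp add: mem_par_iff v0_def algebra_simps)
      qed
      then have "s + U.P k \<in> S"
        unfolding S_eq[OF s] by (simp add: A.add Ak)
      from s_orth[OF this] have orth: "(x0 - s) \<bullet> U.P k = 0" by simp
      have "h = T x0 - s" using xy' by (simp add: h_def)
      then have "h \<bullet> k = (x0 - s) \<bullet> U.P k - (1/\<beta>) * (A (x0 - s) \<bullet> A (U.P k))"
        unfolding T_s by (simp add: inner_diff_left[of "U.P _"] U.P_symmetric adj')
      with orth Ak show ?thesis by simp
    qed
    then have "h \<in> closure (range Q)"
      by (rule orthogonal_kernel_in_closure_range[OF Q.quadratic_axioms])
    moreover have "filterlim (\<lambda>n. t (Suc n)) at_top sequentially"
      using fista_parameters_at_top[OF t] by (simp add: filterlim_sequentially_Suc)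
    ultimately have "(\<lambda>n. x (Suc n) - s) \<longlonglongrightarrow> 0"
      using t fista_parameters_ge_1[OF t]
      by (intro Q.fista_tendsto_0[OF _ _ shifted]) (simp_all add: fista_parameters_def)
    then have "(\<lambda>n. x (Suc n)) \<longlonglongrightarrow> s" by (simp add: LIM_zero_iff)
    then show ?thesis unfolding s_def by (rule LIMSEQ_imp_Suc)
  qed
  then show ?thesis using T_formula fista_y_tendsto by blast
qed

end
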